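(* Let $V_i=\sum_{j=1}^{6}a_{ij}E_j$, $i=1,2,3$, with $a_{ij}\in C^\infty(X)$, define a distribution $\{V_1,V_2,V_3\}$ on $X$, and write its coefficient matrix as $$\begin{pmatrix} a_{11}&a_{12}&a_{13}&a_{14}&a_{15}&a_{16}\\ a_{21}&a_{22}&a_{23}&a_{24}&a_{25}&a_{26}\\ a_{31}&a_{32}&a_{33}&a_{34}&a_{35}&a_{36}\end{pmatrix}=\begin{pmatrix} x_1&x_2&x_3&x_4&x_5&x_6\\ x_7&x_8&x_9&x_{10}&x_{11}&x_{12}\\ x_{13}&x_{14}&x_{15}&x_{16}&x_{17}&x_{18}\end{pmatrix}.$$ Then the distribution satisfies the special Lagrangian equations of angle $0$, i.e. $\omega$ and $\mathrm{Im}\,\Omega$ vanish on the distribution, if and only if its coefficients satisfy $$\begin{cases} x_1x_{10}-x_4x_7+x_2x_{11}-x_5x_8+x_3x_{12}-x_6x_9=0\\ x_1x_{16}-x_4x_{13}+x_2x_{17}-x_5x_{14}+x_3x_{18}-x_6x_{15}=0\\ x_7x_{16}-x_{10}x_{13}+x_8x_{17}-x_{11}x_{14}+x_9x_{18}-x_{12}x_{15}=0\\ x_1x_8x_{18}-x_1x_{12}x_{14}-x_2x_7x_{18}+x_2x_{12}x_{13}+x_6x_7x_{14}-x_6x_8x_{13}\\ \quad -x_1x_9x_{17}+x_1x_{11}x_{15}+x_3x_7x_{17}-x_3x_{11}x_{13}-x_5x_7x_{15}+x_5x_9x_{13}\\ \quad +x_2x_9x_{16}-x_2x_{10}x_{15}-x_3x_8x_{16}+x_3x_{10}x_{14}+x_4x_8x_{15}-x_4x_9x_{14}\\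 \quad -x_4x_{11}x_{18}+x_4x_{12}x_{17}+x_5x_{10}x_{18}-x_5x_{12}x_{16}-x_6x_{10}x_{17}+x_6x_{11}x_{16}=0. \end{cases}$$
   Context: $X=\Gamma\backslash G$ is a compact 6-dimensional manifold, the quotient of a connected and simply connected Lie group $G$ by a lattice $\Gamma$ (discrete co-compact subgroup). $X$ carries the structure of a compact non-Kähler Calabi-Yau manifold, with complex structure $J$ given by a global co-frame of $(1,0)$-forms $\{\varphi^1,\varphi^2,\varphi^3\}$, holomorphic volume form $\Omega=\varphi^1\wedge\varphi^2\wedge\varphi^3$, and Hermitian metric with fundamental form $\omega=\frac{i}{2}(\varphi^1\wedge\bar\varphi^1+\varphi^2\wedge\bar\varphi^2+\varphi^3\wedge\bar\varphi^3)$, assumed balanced: $d\omega^2=0$. Write $\varphi^k=\theta^k+\sqrt{-1}\,\theta^{3+k}$, $k=1,2,3$; $\{\theta^1,\dots,\theta^6\}$ is a global real co-frame and $\{E_1,\dots,E_6\}$ is the dual global frame. An oriented 3-dimensional submanifold $L$ is a special Lagrangian (SLag) of angle $\vartheta$ if $\omega|_L=0$ and $\mathrm{Im}(e^{-i\vartheta}\Omega)|_L=0$; a distribution satisfies the equations if these forms vanish on it, i.e. $\omega(V_i,V_j)=0$ for all $i,j$ and $\mathrm{Im}(e^{-i\vartheta}\Omega)(V_1,V_2,V_3)=0$. *)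

theory Defs
  imports "HOL-Analysis.Analysis" "HOL-Algebra.Coset" "HOL-Combinatorics.Permutations"
begin

section \<open>Smooth manifolds\<close>

fun Ck_on :: "nat \<Rightarrow> 'a::real_normed_vector set \<Rightarrow> ('a \<Rightarrow> 'b::real_normed_vector) \<Rightarrow> bool" where
  "Ck_on 0 S f \<longleftrightarrow> continuous_on S f"
| "Ck_on (Suc n) S f \<longleftrightarrow>
     f differentiable_on S \<and> (\<forall>v. Ck_on n S (\<lambda>x. frechet_derivative f (at x) v))"

text \<open>Only used for open sets.\<close>

definition smooth_on :: "'a::real_normed_vector set \<Rightarrow> ('a \<Rightarrow> 'b::real_normed_vector) \<Rightarrow> bool" where
  "smooth_on S f \<longleftrightarrow> (\<forall>n. Ck_on n S f)"

type_synonym ('a, 'e) chart = "'a set \<times> ('a \<Rightarrow> 'e)"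

definition smooth_atlas :: "('a::topological_space, 'e::euclidean_space) chart set \<Rightarrow> bool" where
  "smooth_atlas A \<longleftrightarrow>
     (\<forall>(U, u) \<in> A. open U \<and> open (u ` U) \<and> homeomorphism U (u ` U) u (inv_into U u)) \<and>
     (\<Union>(U, u) \<in> A. U) = UNIV \<and>
     (\<forall>(U, u) \<in> A. \<forall>(V, v) \<in> A. smooth_on (u ` (U \<inter> V)) (v \<circ> inv_into U u))"

definition smooth_fun ::
    "('a, 'e::euclidean_space) chart set \<Rightarrow> ('a \<Rightarrow> 'b::real_normed_vector) \<Rightarrow> bool" where
  "smooth_fun A f \<longleftrightarrow> (\<forall>(U, u) \<in> A. smooth_on (u ` U) (f \<circ> inv_into U u))"

text \<open>Smoothness on an open set \<open>W\<close> of a map between two manifolds.\<close>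

definition smooth_map_on ::
    "('a::topological_space, 'e::euclidean_space) chart set \<Rightarrow>
     ('b::topological_space, 'f::euclidean_space) chart set \<Rightarrow> 'a set \<Rightarrow> ('a \<Rightarrow> 'b) \<Rightarrow> bool" where
  "smooth_map_on A B W F \<longleftrightarrow> continuous_on W F \<and>
     (\<forall>(U, u) \<in> A. \<forall>(V, v) \<in> B. smooth_on (u ` (U \<inter> W \<inter> F -` V)) (v \<circ> F \<circ> inv_into U u))"

definition local_diffeo ::
    "('a::topological_space, 'e::euclidean_space) chart set \<Rightarrow>
     ('b::topological_space, 'f::euclidean_space) chart set \<Rightarrow> ('a \<Rightarrow> 'b) \<Rightarrow> bool" where
  "local_diffeo A B F \<longleftrightarrow>
     (\<forall>p. \<exists>W. p \<in> W \<and> open W \<and> open (F ` W) \<and> inj_on F W \<and>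
        smooth_map_on A B W F \<and> smooth_map_on B A (F ` W) (inv_into W F))"

definition prod_atlas ::
    "('a, 'e) chart set \<Rightarrow> ('b, 'f) chart set \<Rightarrow> ('a \<times> 'b, 'e \<times> 'f) chart set" where
  "prod_atlas A B = {(U \<times> V, map_prod u v) | U u V v. (U, u) \<in> A \<and> (V, v) \<in> B}"


section \<open>Lie groups and quotients by discrete subgroups\<close>

definition lie_group ::
    "'g::{t2_space, second_countable_topology} monoid \<Rightarrow> ('g, 'e::euclidean_space) chart set \<Rightarrow> bool" where
  "lie_group G A \<longleftrightarrow>
     group G \<and> carrier G = UNIV \<and> smooth_atlas A \<and>
     smooth_map_on (prod_atlas A A) A UNIV (\<lambda>(g, h). g \<otimes>\<^bsub>G\<^esub> h) \<and>
     smooth_map_on A A UNIV (\<lambda>g. inv\<^bsub>G\<^esub> g)"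

text \<open>
  The manifold with atlas \<open>B\<close> is the quotient of the Lie group \<open>G\<close> by the discrete subgroup
  \<open>\<Gamma>\<close>, with projection \<open>\<pi>\<close>: its points correspond to the cosets \<open>\<Gamma> g\<close>, and its topology and
  smooth structure are the unique ones for which \<open>\<pi>\<close> is a local diffeomorphism.
\<close>

definition quotient_manifold ::
    "'g::{t2_space, second_countable_topology} monoid \<Rightarrow> ('g, 'e::euclidean_space) chart set \<Rightarrow>
     'g set \<Rightarrow> ('g \<Rightarrow> 'x::topological_space) \<Rightarrow> ('x, 'e) chart set \<Rightarrow> bool" where
  "quotient_manifold G A \<Gamma> \<pi> B \<longleftrightarrow>
     subgroup \<Gamma> G \<and> discrete \<Gamma> \<and> surj \<pi> \<and>
     (\<forall>g h. \<pi> g = \<pi> h \<longleftrightarrow> \<Gamma> #>\<^bsub>G\<^esub> g = \<Gamma> #>\<^bsub>G\<^esub> h) \<and>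
     smooth_atlas B \<and> local_diffeo A B \<pi>"


section \<open>Vector fields and differential forms\<close>

text \<open>
  Vector fields are the derivations of the algebra of smooth functions. Since functions are
  total, a derivation is given the value \<open>0\<close> on nonsmooth functions, so that equality of
  derivations is equality of functions.
\<close>

type_synonym 'x vfield = "('x \<Rightarrow> real) \<Rightarrow> 'x \<Rightarrow> real"

definition vector_field :: "('x, 'e::euclidean_space) chart set \<Rightarrow> 'x vfield \<Rightarrow> bool" where
  "vector_field A V \<longleftrightarrow>
     (\<forall>f. smooth_fun A f \<longrightarrow> smooth_fun A (V f)) \<and>
     (\<forall>f. \<not> smooth_fun A f \<longrightarrow> V f = (\<lambda>p. 0)) \<and>
     (\<forall>f g. smooth_fun A f \<longrightarrow> smooth_fun A g \<longrightarrow>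
        V (\<lambda>p. f p + g p) = (\<lambda>p. V f p + V g p) \<and>
        V (\<lambda>p. f p * g p) = (\<lambda>p. f p * V g p + g p * V f p)) \<and>
     (\<forall>c f. smooth_fun A f \<longrightarrow> V (\<lambda>p. c * f p) = (\<lambda>p. c * V f p))"

definition vf_add :: "'x vfield \<Rightarrow> 'x vfield \<Rightarrow> 'x vfield" where
  "vf_add V W = (\<lambda>f p. V f p + W f p)"

definition vf_scale :: "('x \<Rightarrow> real) \<Rightarrow> 'x vfield \<Rightarrow> 'x vfield" where
  "vf_scale h V = (\<lambda>f p. h p * V f p)"

definition lie_bracket :: "'x vfield \<Rightarrow> 'x vfield \<Rightarrow> 'x vfield" where
  "lie_bracket V W = (\<lambda>f p. V (W f) p - W (V f) p)"

definition vf_complex :: "'x vfield \<Rightarrow> ('x \<Rightarrow> complex) \<Rightarrow> 'x \<Rightarrow> complex" where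
  "vf_complex V f = (\<lambda>p. Complex (V (\<lambda>q. Re (f q)) p) (V (\<lambda>q. Im (f q)) p))"

text \<open>
  Complex-valued differential forms of degree \<open>k\<close> are the alternating maps on \<open>k\<close>-tuples of
  (real) vector fields that are multilinear over the smooth functions. Tuples are lists of
  length \<open>k\<close>; values on other lists are irrelevant.
\<close>

type_synonym 'x dform = "'x vfield list \<Rightarrow> 'x \<Rightarrow> complex"

definition vfields :: "('x, 'e::euclidean_space) chart set \<Rightarrow> nat \<Rightarrow> 'x vfield list set" where
  "vfields A k = {vs. length vs = k \<and> (\<forall>V \<in> set vs. vector_field A V)}"

definition form :: "('x, 'e::euclidean_space) chart set \<Rightarrow> nat \<Rightarrow> 'x dform \<Rightarrow> bool" where
  "form A k \<alpha> \<longleftrightarrow>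
     (\<forall>vs \<in> vfields A k.
        smooth_fun A (\<alpha> vs) \<and>
        (\<forall>i<k. \<forall>V W. vector_field A V \<longrightarrow> vector_field A W \<longrightarrow>
           \<alpha> (vs[i := vf_add V W]) = (\<lambda>p. \<alpha> (vs[i := V]) p + \<alpha> (vs[i := W]) p)) \<and>
        (\<forall>i<k. \<forall>V h. vector_field A V \<longrightarrow> smooth_fun A h \<longrightarrow>
           \<alpha> (vs[i := vf_scale h V]) = (\<lambda>p. complex_of_real (h p) * \<alpha> (vs[i := V]) p)) \<and>
        (\<forall>i<k. \<forall>j<k. i \<noteq> j \<longrightarrow> vs ! i = vs ! j \<longrightarrow> \<alpha> vs = (\<lambda>p. 0)))"

text \<open>
  Wedge product of a \<open>k\<close>-form and an \<open>l\<close>-form, normalised so that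
  \<open>(\<alpha> \<and> \<beta>)(V, W) = \<alpha>(V) \<beta>(W) - \<alpha>(W) \<beta>(V)\<close> for one-forms.
\<close>

definition wedge :: "nat \<Rightarrow> nat \<Rightarrow> 'x dform \<Rightarrow> 'x dform \<Rightarrow> 'x dform" where
  "wedge k l \<alpha> \<beta> = (\<lambda>vs p.
     (\<Sum>\<sigma> | \<sigma> permutes {..<k + l}.
        of_int (sign \<sigma>) * \<alpha> (map (\<lambda>i. vs ! \<sigma> i) [0..<k]) p
                         * \<beta> (map (\<lambda>i. vs ! \<sigma> i) [k..<k + l]) p) / (fact k * fact l))"

definition conj_form :: "'x dform \<Rightarrow> 'x dform" where
  "conj_form \<alpha> = (\<lambda>vs p. cnj (\<alpha> vs p))"

text \<open>The exterior derivative, by the invariant (Cartan--Koszul) formula.\<close>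

definition ext_deriv :: "'x dform \<Rightarrow> 'x dform" where
  "ext_deriv \<alpha> = (\<lambda>vs p.
     (\<Sum>i<length vs. (-1) ^ i * vf_complex (vs ! i) (\<alpha> (nths vs (- {i}))) p) +
     (\<Sum>j<length vs. \<Sum>i<j.
        (-1) ^ (i + j) * \<alpha> (lie_bracket (vs ! i) (vs ! j) # nths vs (- {i, j})) p))"

definition closed_form :: "('x, 'e::euclidean_space) chart set \<Rightarrow> nat \<Rightarrow> 'x dform \<Rightarrow> bool" where
  "closed_form A k \<alpha> \<longleftrightarrow> form A k \<alpha> \<and> (\<forall>vs \<in> vfields A (Suc k). ext_deriv \<alpha> vs = (\<lambda>p. 0))"


section \<open>Complex structures and Hermitian metrics\<close>

text \<open>
  A complex structure is an integrable (vanishing Nijenhuis tensor) almost complex structure.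
\<close>

definition complex_structure ::
    "('x, 'e::euclidean_space) chart set \<Rightarrow> ('x vfield \<Rightarrow> 'x vfield) \<Rightarrow> bool" where
  "complex_structure A J \<longleftrightarrow>
     (\<forall>V. vector_field A V \<longrightarrow>
        vector_field A (J V) \<and> J (J V) = vf_scale (\<lambda>p. -1) V \<and>
        (\<forall>h. smooth_fun A h \<longrightarrow> J (vf_scale h V) = vf_scale h (J V)) \<and>
        (\<forall>W. vector_field A W \<longrightarrow>
           J (vf_add V W) = vf_add (J V) (J W) \<and>
           (\<forall>f p. lie_bracket (J V) (J W) f p - J (lie_bracket (J V) W) f p
                  - J (lie_bracket V (J W)) f p - lie_bracket V W f p = 0)))"

text \<open>Forms of type \<open>(k,0)\<close>.\<close>

definition form_k0 ::
    "('x, 'e::euclidean_space) chart set \<Rightarrow> ('x vfield \<Rightarrow> 'x vfield) \<Rightarrow> nat \<Rightarrow> 'x dform \<Rightarrow> bool" where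
  "form_k0 A J k \<alpha> \<longleftrightarrow> form A k \<alpha> \<and>
     (\<forall>vs \<in> vfields A k. \<forall>i<k. \<alpha> (vs[i := J (vs ! i)]) = (\<lambda>p. \<i> * \<alpha> vs p))"

text \<open>
  For \<open>\<alpha>\<close> of type \<open>(k,0)\<close>, the \<open>(k,1)\<close>-component of \<open>d\<alpha>\<close> is the Dolbeault derivative of
  \<open>\<alpha>\<close>; it vanishes, i.e. \<open>\<alpha>\<close> is holomorphic, iff \<open>d\<alpha>\<close> is of type \<open>(k+1,0)\<close>.
\<close>

definition holomorphic_form ::
    "('x, 'e::euclidean_space) chart set \<Rightarrow> ('x vfield \<Rightarrow> 'x vfield) \<Rightarrow> nat \<Rightarrow> 'x dform \<Rightarrow> bool" where
  "holomorphic_form A J k \<alpha> \<longleftrightarrow> form_k0 A J k \<alpha> \<and> form_k0 A J (Suc k) (ext_deriv \<alpha>)"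

text \<open>
  A global coframe of \<open>(1,0)\<close>-forms on a manifold of complex dimension \<open>n\<close> (the dimension is
  fixed by the model space of the atlas): \<open>n\<close> pointwise linearly independent \<open>(1,0)\<close>-forms.
\<close>

definition coframe_10 ::
    "('x, 'e::euclidean_space) chart set \<Rightarrow> ('x vfield \<Rightarrow> 'x vfield) \<Rightarrow> (nat \<Rightarrow> 'x dform) \<Rightarrow> bool" where
  "coframe_10 A J \<phi> \<longleftrightarrow> even DIM('e) \<and>
     (\<forall>k \<in> {1..DIM('e) div 2}. form_k0 A J 1 (\<phi> k)) \<and>
     (\<forall>p. \<forall>c :: nat \<Rightarrow> complex.
        (\<forall>V. vector_field A V \<longrightarrow> (\<Sum>k = 1..DIM('e) div 2. c k * \<phi> k [V] p) = 0) \<longrightarrow>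
        (\<forall>k \<in> {1..DIM('e) div 2}. c k = 0))"

text \<open>
  \<open>\<omega>\<close> is the fundamental form of a Hermitian metric \<open>g\<close>, where \<open>g(V,W) = \<omega>(V,JW)\<close>.
  A vector field is nonzero at a point iff it does not annihilate all smooth functions there.
\<close>

definition hermitian_form ::
    "('x, 'e::euclidean_space) chart set \<Rightarrow> ('x vfield \<Rightarrow> 'x vfield) \<Rightarrow> 'x dform \<Rightarrow> bool" where
  "hermitian_form A J \<omega> \<longleftrightarrow> form A 2 \<omega> \<and>
     (\<forall>V W. vector_field A V \<longrightarrow> vector_field A W \<longrightarrow>
        (\<forall>p. Im (\<omega> [V, W] p) = 0) \<and> \<omega> [J V, J W] = \<omega> [V, W]) \<and>
     (\<forall>V p. vector_field A V \<longrightarrow> (\<exists>f. V f p \<noteq> 0) \<longrightarrow> Re (\<omega> [V, J V] p) > 0)"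

definition admits_kaehler ::
    "('x, 'e::euclidean_space) chart set \<Rightarrow> ('x vfield \<Rightarrow> 'x vfield) \<Rightarrow> bool" where
  "admits_kaehler A J \<longleftrightarrow> (\<exists>\<kappa>. hermitian_form A J \<kappa> \<and> closed_form A 2 \<kappa>)"

definition fundamental_form :: "(nat \<Rightarrow> 'x dform) \<Rightarrow> 'x dform" where
  "fundamental_form \<phi> = (\<lambda>vs p.
     \<i> / 2 * (\<Sum>k = 1..3. wedge 1 1 (\<phi> k) (conj_form (\<phi> k)) vs p))"

definition volume_form :: "(nat \<Rightarrow> 'x dform) \<Rightarrow> 'x dform" where
  "volume_form \<phi> = wedge 2 1 (wedge 1 1 (\<phi> 1) (\<phi> 2)) (\<phi> 3)"

definition balanced :: "('x, 'e::euclidean_space) chart set \<Rightarrow> 'x dform \<Rightarrow> bool" where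
  "balanced A \<omega> \<longleftrightarrow> closed_form A 4 (wedge 2 2 \<omega> \<omega>)"


section \<open>Special Lagrangian distributions\<close>

text \<open>
  The special Lagrangian equations of angle \<open>\<theta>\<close> for the distribution generated by
  \<open>V 1, V 2, V 3\<close>.
\<close>

definition slag_distribution ::
    "real \<Rightarrow> 'x dform \<Rightarrow> 'x dform \<Rightarrow> (nat \<Rightarrow> 'x vfield) \<Rightarrow> bool" where
  "slag_distribution \<theta> \<omega> \<Omega> V \<longleftrightarrow>
     (\<forall>i \<in> {1..3}. \<forall>j \<in> {1..3}. \<forall>p. \<omega> [V i, V j] p = 0) \<and>
     (\<forall>p. Im (exp (- \<i> * complex_of_real \<theta>) * \<Omega> [V 1, V 2, V 3] p) = 0)"

end

theory Submission
  imports Defs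
begin

text \<open>
  A one-form is linear over the smooth functions, so on \<open>V i = (\<Sum>j. a i j E j)\<close> the
  form \<open>\<phi> k\<close> takes the value \<open>a i k + \<i> a i (3 + k)\<close>, by duality of the frame \<open>E\<close>
  and the real coframe \<open>\<theta>\<close> (lemma \<open>one_form_vf_sum\<close>). Call this complex number \<open>z i k\<close>.
  Then \<open>\<omega>(V i, V j)\<close> is the sum over \<open>k\<close> of
  \<open>Re (z i k) Im (z j k) - Im (z i k) Re (z j k)\<close> (lemma \<open>fundamental_form_eval\<close>), and
  \<open>\<Omega>(V 1, V 2, V 3)\<close> is the determinant of the complex \<open>3 \<times> 3\<close> matrix \<open>z\<close>
  (lemma \<open>volume_form_eval\<close>). The first expression is skew in \<open>i, j\<close>, so of the nine
  Lagrangian equations only those for the pairs (1,2), (1,3), (2,3) carry information; they are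
  the three quadrics. The imaginary part of the determinant is the cubic: each of its six
  products of three complex numbers contributes the four real monomials with an odd number of
  imaginary parts.

  The remaining point is that linearity applies: one-forms are additive on genuine vector
  fields, so every partial sum of \<open>\<Sum>j. a i j E j\<close> must again be a derivation preserving
  smooth functions. This rests on smooth functions being closed under sums and products.
\<close>

section \<open>The algebra of smooth functions\<close>

lemma Ck_on_cong:
  assumes "open S" "Ck_on n S f" "\<And>y. y \<in> S \<Longrightarrow> f y = g y"
  shows "Ck_on n S g"
  using assms(2,3)
proof (induction n arbitrary: f g)
  case 0
  then show ?case by (simp cong: continuous_on_cong)
next
  case (Suc n)
  have df: "f differentiable at y" if "y \<in> S" for y
    using Suc.prems(1) that by (simp add: differentiable_on_eq_differentiable_at[OF assms(1)])
  have "g differentiable_on S"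
    unfolding differentiable_on_eq_differentiable_at[OF assms(1)]
    using df assms(1) Suc.prems(2)
    by (meson differentiable_def has_derivative_transform_within_open)
  moreover have "Ck_on n S (\<lambda>y. frechet_derivative g (at y) v)" for v
  proof (rule Suc.IH)
    show "Ck_on n S (\<lambda>y. frechet_derivative f (at y) v)"
      using Suc.prems(1) by simp
    show "frechet_derivative f (at y) v = frechet_derivative g (at y) v" if "y \<in> S" for y
      using frechet_derivative_transform_within_open[OF df[OF that] assms(1) that Suc.prems(2)]
      by simp
  qed
  ultimately show ?case by simp
qed

text \<open>
  The recursion defining \<open>Ck_on\<close> speaks of \<open>frechet_derivative\<close>, a Hilbert choice. Derivatives
  at interior points are unique, so any explicitly known derivative may take its place.
\<close>

lemma Ck_on_SucI:
  assumes "open S" "\<And>y. y \<in> S \<Longrightarrow> (f has_derivative f' y) (at y)"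
    and "\<And>v. Ck_on n S (\<lambda>y. f' y v)"
  shows "Ck_on (Suc n) S f"
proof -
  have "Ck_on n S (\<lambda>y. frechet_derivative f (at y) v)" for v
    by (rule Ck_on_cong[OF assms(1) assms(3)[of v]]) (metis assms(2) frechet_derivative_at)
  moreover have "f differentiable_on S"
    using assms(2) by (auto simp: differentiable_on_eq_differentiable_at[OF assms(1)] differentiable_def)
  ultimately show ?thesis by simp
qed

lemma Ck_on_Suc_has_derivative:
  assumes "open S" "Ck_on (Suc n) S f" "y \<in> S"
  shows "(f has_derivative frechet_derivative f (at y)) (at y)"
  using assms
  by (simp add: differentiable_on_eq_differentiable_at frechet_derivative_works[symmetric])

lemma Ck_on_const: "Ck_on n S (\<lambda>y. c)"
  by (induction n arbitrary: c) auto

lemma Ck_on_add: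
  assumes "open S" "Ck_on n S f" "Ck_on n S g"
  shows "Ck_on n S (\<lambda>y. f y + g y)"
  using assms(2,3)
proof (induction n arbitrary: f g)
  case 0
  then show ?case by (auto intro: continuous_on_add)
next
  case (Suc n)
  show ?case
    by (rule Ck_on_SucI[OF assms(1)
          has_derivative_add[OF Ck_on_Suc_has_derivative[OF assms(1) Suc.prems(1)]
            Ck_on_Suc_has_derivative[OF assms(1) Suc.prems(2)]]])
      (use Suc in auto)
qed

text \<open>
  The factors are taken smooth to all orders: the product rule differentiates one factor and
  leaves the other, and smoothness is inherited by the derivative and by the untouched factor
  alike, whereas finite orders would have to be lowered.
\<close>

lemma smooth_on_mult:
  fixes f g :: "'a::real_normed_vector \<Rightarrow> 'b::real_normed_algebra"
  assumes "open S" "smooth_on S f" "smooth_on S g"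
  shows "smooth_on S (\<lambda>y. f y * g y)"
proof -
  have smooth_deriv: "smooth_on S (\<lambda>y. frechet_derivative h (at y) v)"
    if "smooth_on S h" for h :: "'a \<Rightarrow> 'b" and v
    using that unfolding smooth_on_def by (metis Ck_on.simps(2))
  have "Ck_on n S (\<lambda>y. f y * g y)" for n
    using assms(2,3)
  proof (induction n arbitrary: f g)
    case 0
    then have "Ck_on 0 S f" "Ck_on 0 S g" unfolding smooth_on_def by blast+
    then show ?case by (auto intro: continuous_on_mult)
  next
    case (Suc n)
    then have Ck: "Ck_on (Suc n) S f" "Ck_on (Suc n) S g" unfolding smooth_on_def by blast+
    show ?case
      by (rule Ck_on_SucI[OF assms(1)
            has_derivative_mult[OF Ck_on_Suc_has_derivative[OF assms(1) Ck(1)]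
              Ck_on_Suc_has_derivative[OF assms(1) Ck(2)]]])
        (auto intro!: Ck_on_add[OF assms(1)] Suc.IH smooth_deriv Suc.prems)
  qed
  then show ?thesis by (simp add: smooth_on_def)
qed

lemma smooth_fun_const: "smooth_fun A (\<lambda>p. c)"
  by (auto simp: smooth_fun_def smooth_on_def comp_def Ck_on_const)

lemma smooth_fun_add:
  assumes "smooth_atlas A" "smooth_fun A f" "smooth_fun A g"
  shows "smooth_fun A (\<lambda>p. f p + g p)"
  unfolding smooth_fun_def
proof clarify
  fix U u assume chart: "(U, u) \<in> A"
  then have "open (u ` U)" using assms(1) by (auto simp: smooth_atlas_def)
  moreover have "smooth_on (u ` U) (f \<circ> inv_into U u)" "smooth_on (u ` U) (g \<circ> inv_into U u)"
    using assms(2,3) chart by (auto simp: smooth_fun_def)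
  ultimately show "smooth_on (u ` U) ((\<lambda>p. f p + g p) \<circ> inv_into U u)"
    by (auto simp: smooth_on_def comp_def intro: Ck_on_add)
qed

lemma smooth_fun_mult:
  fixes f g :: "'x::topological_space \<Rightarrow> 'b::real_normed_algebra"
  assumes "smooth_atlas A" "smooth_fun A f" "smooth_fun A g"
  shows "smooth_fun A (\<lambda>p. f p * g p)"
  unfolding smooth_fun_def
proof clarify
  fix U u assume chart: "(U, u) \<in> A"
  then have "open (u ` U)" using assms(1) by (auto simp: smooth_atlas_def)
  moreover have "smooth_on (u ` U) (f \<circ> inv_into U u)" "smooth_on (u ` U) (g \<circ> inv_into U u)"
    using assms(2,3) chart by (auto simp: smooth_fun_def)
  ultimately show "smooth_on (u ` U) ((\<lambda>p. f p * g p) \<circ> inv_into U u)"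
    using smooth_on_mult by (fastforce simp: comp_def)
qed

section \<open>Linear combinations of vector fields\<close>

lemma vector_field_zero: "vector_field A (\<lambda>f p. 0)"
  by (simp add: vector_field_def smooth_fun_const)

lemma vector_field_add:
  assumes "smooth_atlas A" "vector_field A V" "vector_field A W"
  shows "vector_field A (vf_add V W)"
  using assms(2,3) unfolding vector_field_def vf_add_def
  by (simp add: smooth_fun_add[OF assms(1)] algebra_simps)

lemma vector_field_scale:
  assumes "smooth_atlas A" "smooth_fun A h" "vector_field A V"
  shows "vector_field A (vf_scale h V)"
  using assms(2,3) unfolding vector_field_def vf_scale_def
  by (simp add: smooth_fun_mult[OF assms(1)] algebra_simps)

lemma one_form_add:
  assumes "form A 1 \<alpha>" "vector_field A V" "vector_field A W"
  shows "\<alpha> [vf_add V W] p = \<alpha> [V] p + \<alpha> [W] p"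
proof -
  have "[V] \<in> vfields A 1" using assms(2) by (simp add: vfields_def)
  with assms have "\<alpha> ([V][0 := vf_add V W]) = (\<lambda>p. \<alpha> ([V][0 := V]) p + \<alpha> ([V][0 := W]) p)"
    unfolding form_def by (meson zero_less_one)
  then show ?thesis by simp
qed

lemma one_form_scale:
  assumes "form A 1 \<alpha>" "vector_field A V" "smooth_fun A h"
  shows "\<alpha> [vf_scale h V] p = of_real (h p) * \<alpha> [V] p"
proof -
  have "[V] \<in> vfields A 1" using assms(2) by (simp add: vfields_def)
  with assms have "\<alpha> ([V][0 := vf_scale h V]) = (\<lambda>p. of_real (h p) * \<alpha> ([V][0 := V]) p)"
    unfolding form_def by (meson zero_less_one)
  then show ?thesis by simp
qed

lemma vector_field_sum:
  assumes "smooth_atlas A" "finite S"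
    and "\<And>j. j \<in> S \<Longrightarrow> smooth_fun A (c j)" "\<And>j. j \<in> S \<Longrightarrow> vector_field A (E j)"
  shows "vector_field A (\<lambda>f p. \<Sum>j\<in>S. c j p * E j f p)"
  using assms(2-4)
proof (induction S rule: finite_induct)
  case empty
  then show ?case by (simp add: vector_field_zero)
next
  case (insert j S)
  then have "vector_field A (vf_add (vf_scale (c j) (E j)) (\<lambda>f p. \<Sum>j\<in>S. c j p * E j f p))"
    by (intro vector_field_add vector_field_scale assms(1)) auto
  with insert(1,2) show ?case by (simp add: vf_add_def vf_scale_def)
qed

lemma one_form_vf_sum:
  assumes "smooth_atlas A" "form A 1 \<alpha>" "finite S"
    and "\<And>j. j \<in> S \<Longrightarrow> smooth_fun A (c j)" "\<And>j. j \<in> S \<Longrightarrow> vector_field A (E j)"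
  shows "\<alpha> [\<lambda>f p. \<Sum>j\<in>S. c j p * E j f p] p = (\<Sum>j\<in>S. of_real (c j p) * \<alpha> [E j] p)"
  using assms(3-5)
proof (induction S rule: finite_induct)
  case empty
  \<comment> \<open>The zero field is the multiple of itself by the zero function.\<close>
  have "\<alpha> [vf_scale (\<lambda>p. 0) (\<lambda>f p. 0)] p = 0"
    by (simp add: one_form_scale[OF assms(2) vector_field_zero smooth_fun_const])
  then show ?case by (simp add: vf_scale_def)
next
  case (insert j S)
  have "\<alpha> [vf_add (vf_scale (c j) (E j)) (\<lambda>f p. \<Sum>j\<in>S. c j p * E j f p)] p =
      of_real (c j p) * \<alpha> [E j] p + (\<Sum>j\<in>S. of_real (c j p) * \<alpha> [E j] p)"
    using insert
    by (simp add: one_form_add[OF assms(2)] one_form_scale[OF assms(2)]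
        vector_field_scale[OF assms(1)] vector_field_sum[OF assms(1)])
  with insert(1,2) show ?case by (simp add: vf_add_def vf_scale_def)
qed

section \<open>Wedge products of one-forms\<close>

lemma wedge_one_one:
  "wedge 1 1 \<alpha> \<beta> [U, V] p = \<alpha> [U] p * \<beta> [V] p - \<alpha> [V] p * \<beta> [U] p"
proof -
  have set: "{..<1 + 1} = insert 0 {1::nat}" by auto
  show ?thesis
    unfolding wedge_def set
    by (subst sum_over_permutations_insert)
      (simp_all add: permutes_sing sign_swap_id upt_rec transpose_def)
qed

text \<open>
  Each of the six terms of the determinant arises twice in the sum over permutations, since
  the inner wedge product is already skew; the normalising factor \<open>2!\<close> removes the repetition.
\<close>

lemma wedge_one_one_one:
  "wedge 2 1 (wedge 1 1 \<alpha> \<beta>) \<gamma> [U, V, W] p =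
     \<alpha> [U] p * (\<beta> [V] p * \<gamma> [W] p - \<beta> [W] p * \<gamma> [V] p)
   - \<alpha> [V] p * (\<beta> [U] p * \<gamma> [W] p - \<beta> [W] p * \<gamma> [U] p)
   + \<alpha> [W] p * (\<beta> [U] p * \<gamma> [V] p - \<beta> [V] p * \<gamma> [U] p)"
proof -
  have set: "{..<2 + 1} = insert 0 (insert 1 {2::nat})" by auto
  have upt: "[0..<2] = [0, Suc 0]" "[2..<2 + 1] = [2]" by (simp_all add: upt_rec)
  show ?thesis
    unfolding wedge_def[of 2 1] set upt
    by (subst sum_over_permutations_insert, simp, simp)+
      (simp add: permutes_sing sign_swap_id sign_compose permutation_swap_id
        wedge_one_one[unfolded One_nat_def], algebra)
qed

lemma fundamental_form_eval:
  "fundamental_form \<phi> [U, V] p =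
     of_real (\<Sum>k = 1..3. Re (\<phi> k [U] p) * Im (\<phi> k [V] p) - Im (\<phi> k [U] p) * Re (\<phi> k [V] p))"
proof -
  have "z * cnj w - w * cnj z = - 2 * \<i> * of_real (Re z * Im w - Im z * Re w)" for z w
    by (simp add: complex_eq_iff algebra_simps)
  then show ?thesis
    by (simp add: fundamental_form_def wedge_one_one[unfolded One_nat_def] conj_form_def
        sum_distrib_left)
qed

lemma volume_form_eval:
  "volume_form \<phi> [U, V, W] p =
     \<phi> 1 [U] p * (\<phi> 2 [V] p * \<phi> 3 [W] p - \<phi> 2 [W] p * \<phi> 3 [V] p)
   - \<phi> 1 [V] p * (\<phi> 2 [U] p * \<phi> 3 [W] p - \<phi> 2 [W] p * \<phi> 3 [U] p)
   + \<phi> 1 [W] p * (\<phi> 2 [U] p * \<phi> 3 [V] p - \<phi> 2 [V] p * \<phi> 3 [U] p)"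
  by (simp only: volume_form_def wedge_one_one_one)

section \<open>The special Lagrangian equations in coordinates\<close>

theorem lemma3p1:
  fixes G :: "'g::{t2_space, second_countable_topology} monoid"
    and AG :: "('g, real ^ 6) chart set"
    and \<Gamma> :: "'g set"
    and \<pi> :: "'g \<Rightarrow> 'x::topological_space"
    and A :: "('x, real ^ 6) chart set"
    and J :: "'x vfield \<Rightarrow> 'x vfield"
    and \<phi> :: "nat \<Rightarrow> 'x dform"
    and \<theta> :: "nat \<Rightarrow> 'x vfield list \<Rightarrow> 'x \<Rightarrow> real"
    and E V :: "nat \<Rightarrow> 'x vfield"
    and a :: "nat \<Rightarrow> nat \<Rightarrow> 'x \<Rightarrow> real"
    and x :: "nat \<Rightarrow> 'x \<Rightarrow> real"
  assumes "lie_group G AG"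
    and "connected (UNIV :: 'g set)"
    and "simply_connected (UNIV :: 'g set)"
    and "quotient_manifold G AG \<Gamma> \<pi> A"
    and "compact (UNIV :: 'x set)"
    and "complex_structure A J"
    and "\<not> admits_kaehler A J"
    and "coframe_10 A J \<phi>"
    and "holomorphic_form A J 3 (volume_form \<phi>)"
    and "hermitian_form A J (fundamental_form \<phi>)"
    and "balanced A (fundamental_form \<phi>)"
    and "\<And>k vs p. k \<in> {1..3} \<Longrightarrow>
           \<phi> k vs p = complex_of_real (\<theta> k vs p) + \<i> * complex_of_real (\<theta> (3 + k) vs p)"
    and "\<And>j. j \<in> {1..6} \<Longrightarrow> vector_field A (E j)"
    and "\<And>i j p. i \<in> {1..6} \<Longrightarrow> j \<in> {1..6} \<Longrightarrow> \<theta> i [E j] p = (if i = j then 1 else 0)"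
    and "\<And>i j. i \<in> {1..3} \<Longrightarrow> j \<in> {1..6} \<Longrightarrow> smooth_fun A (a i j)"
    and "\<And>i. i \<in> {1..3} \<Longrightarrow> V i = (\<lambda>f p. \<Sum>j = 1..6. a i j p * E j f p)"
    and "\<And>i j. i \<in> {1..3} \<Longrightarrow> j \<in> {1..6} \<Longrightarrow> a i j = x (6 * (i - 1) + j)"
  shows "slag_distribution 0 (fundamental_form \<phi>) (volume_form \<phi>) V \<longleftrightarrow>
    (\<forall>p.
      x 1 p * x 10 p - x 4 p * x 7 p + x 2 p * x 11 p - x 5 p * x 8 p
        + x 3 p * x 12 p - x 6 p * x 9 p = 0 \<and>
      x 1 p * x 16 p - x 4 p * x 13 p + x 2 p * x 17 p - x 5 p * x 14 p
        + x 3 p * x 18 p - x 6 p * x 15 p = 0 \<and>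
      x 7 p * x 16 p - x 10 p * x 13 p + x 8 p * x 17 p - x 11 p * x 14 p
        + x 9 p * x 18 p - x 12 p * x 15 p = 0 \<and>
      x 1 p * x 8 p * x 18 p - x 1 p * x 12 p * x 14 p - x 2 p * x 7 p * x 18 p
        + x 2 p * x 12 p * x 13 p + x 6 p * x 7 p * x 14 p - x 6 p * x 8 p * x 13 p
        - x 1 p * x 9 p * x 17 p + x 1 p * x 11 p * x 15 p + x 3 p * x 7 p * x 17 p
        - x 3 p * x 11 p * x 13 p - x 5 p * x 7 p * x 15 p + x 5 p * x 9 p * x 13 p
        + x 2 p * x 9 p * x 16 p - x 2 p * x 10 p * x 15 p - x 3 p * x 8 p * x 16 p
        + x 3 p * x 10 p * x 14 p + x 4 p * x 8 p * x 15 p - x 4 p * x 9 p * x 14 p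
        - x 4 p * x 11 p * x 18 p + x 4 p * x 12 p * x 17 p + x 5 p * x 10 p * x 18 p
        - x 5 p * x 12 p * x 16 p - x 6 p * x 10 p * x 17 p + x 6 p * x 11 p * x 16 p = 0)"
proof -
  have atlas: "smooth_atlas A" using assms(4) by (simp add: quotient_manifold_def)
  have form: "form A 1 (\<phi> k)" if "k \<in> {1..3}" for k
    using assms(8) that by (simp add: coframe_10_def form_k0_def)
  have \<phi>_V: "\<phi> k [V i] p = Complex (a i k p) (a i (3 + k) p)"
    if i: "i \<in> {1..3}" and k: "k \<in> {1..3}" for i k p
  proof -
    have "\<phi> k [V i] p = (\<Sum>j = 1..6. of_real (a i j p) * \<phi> k [E j] p)"
      unfolding assms(16)[OF i]
      using one_form_vf_sum[OF atlas form[OF k], of "{1..6}" "a i" E p] assms(13) assms(15)[OF i]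
      by simp
    also have "\<dots> = (\<Sum>j = 1..6. of_real (a i j p) *
        ((if j = k then 1 else 0) + \<i> * (if j = 3 + k then 1 else 0)))"
      using k by (intro sum.cong) (auto simp: assms(12,14))
    also have "\<dots> = (\<Sum>j = 1..6. if j = k then of_real (a i j p) else 0) +
        (\<Sum>j = 1..6. if j = 3 + k then \<i> * of_real (a i j p) else 0)"
      unfolding sum.distrib[symmetric] by (intro sum.cong) auto
    also have "\<dots> = Complex (a i k p) (a i (3 + k) p)"
      using k by (auto simp: complex_eq_iff)
    finally show ?thesis .
  qed
  have three: "{1..3} = {1, 2, 3::nat}" by auto
  define q where
    "q i j p = (\<Sum>k = 1..3. a i k p * a j (3 + k) p - a i (3 + k) p * a j k p)" for i j p
  have \<omega>_V: "fundamental_form \<phi> [V i, V j] p = of_real (q i j p)"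
    if "i \<in> {1..3}" "j \<in> {1..3}" for i j p
    unfolding fundamental_form_eval q_def using that by (simp add: \<phi>_V)
  have q_skew: "q j i p = - q i j p" for i j p
    by (simp add: q_def sum_negf[symmetric] mult.commute)
  have q_diag: "q i i p = 0" for i p
    using q_skew[of i i p] by simp
  \<comment> \<open>Simplification computes the index \<open>6 * (1 - 1) + 2\<close> to \<open>Suc (Suc 0)\<close>; the rule
      \<open>numeral_2_eq_2\<close> brings the literal index 2 to the same form, here and for the cubic.\<close>
  have q_12: "q 1 2 p = x 1 p * x 10 p - x 4 p * x 7 p + x 2 p * x 11 p - x 5 p * x 8 p
        + x 3 p * x 12 p - x 6 p * x 9 p"
    and q_13: "q 1 3 p = x 1 p * x 16 p - x 4 p * x 13 p + x 2 p * x 17 p - x 5 p * x 14 p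
        + x 3 p * x 18 p - x 6 p * x 15 p"
    and q_23: "q 2 3 p = x 7 p * x 16 p - x 10 p * x 13 p + x 8 p * x 17 p - x 11 p * x 14 p
        + x 9 p * x 18 p - x 12 p * x 15 p" for p
    unfolding q_def three by (simp_all add: assms(17) numeral_2_eq_2)
  have lagrangian: "(\<forall>i \<in> {1..3}. \<forall>j \<in> {1..3}. \<forall>p. fundamental_form \<phi> [V i, V j] p = 0) \<longleftrightarrow>
      (\<forall>p. q 1 2 p = 0 \<and> q 1 3 p = 0 \<and> q 2 3 p = 0)"
    (is "?L \<longleftrightarrow> ?R")
  proof
    show "?R" if ?L
      using that \<omega>_V by simp
    show "?L" if ?R
      using that \<omega>_V q_diag q_skew[of 1 2] q_skew[of 1 3] q_skew[of 2 3]
      unfolding three by auto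
  qed
  have \<Omega>_V: "Im (volume_form \<phi> [V 1, V 2, V 3] p) =
      x 1 p * x 8 p * x 18 p - x 1 p * x 12 p * x 14 p - x 2 p * x 7 p * x 18 p
        + x 2 p * x 12 p * x 13 p + x 6 p * x 7 p * x 14 p - x 6 p * x 8 p * x 13 p
        - x 1 p * x 9 p * x 17 p + x 1 p * x 11 p * x 15 p + x 3 p * x 7 p * x 17 p
        - x 3 p * x 11 p * x 13 p - x 5 p * x 7 p * x 15 p + x 5 p * x 9 p * x 13 p
        + x 2 p * x 9 p * x 16 p - x 2 p * x 10 p * x 15 p - x 3 p * x 8 p * x 16 p
        + x 3 p * x 10 p * x 14 p + x 4 p * x 8 p * x 15 p - x 4 p * x 9 p * x 14 p
        - x 4 p * x 11 p * x 18 p + x 4 p * x 12 p * x 17 p + x 5 p * x 10 p * x 18 p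
        - x 5 p * x 12 p * x 16 p - x 6 p * x 10 p * x 17 p + x 6 p * x 11 p * x 16 p" for p
    unfolding volume_form_eval by (simp add: \<phi>_V assms(17) numeral_2_eq_2 algebra_simps)
  show ?thesis
    unfolding slag_distribution_def lagrangian q_12 q_13 q_23
    by (simp add: \<Omega>_V all_conj_distrib conj_assoc del: One_nat_def)
qed

end
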